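(* Let $1 \le K \le N$ be integers, let $\mathbf{H} \in \mathbb{C}^{K\times N}$, let $\mathrm{SNR} > 0$ be real, and let $$\mathbf{M} = \left(\frac{K}{\mathrm{SNR}}\mathbf{I} + \mathbf{H}\mathbf{H}^{\mathrm{H}}\right)^{-1} \in \mathbb{C}^{K\times K}.$$ Let $\mathbf{U} \in \mathbb{C}^{K\times K}$ be upper unitriangular and $\mathbf{\Lambda} \in \mathbb{R}^{K\times K}$ be diagonal such that $\mathbf{M} = \mathbf{U}^{\mathrm{H}}\mathbf{\Lambda}\mathbf{U}$. Consider the optimization problem $$\text{minimize } f(\mathbf{A},\mathbf{D}) = \mathrm{Tr}\left(\mathbf{A}^{\mathrm{H}}\mathbf{D}^{\mathrm{H}}\mathbf{M}\mathbf{D}\mathbf{A}\right)$$ over all pairs $(\mathbf{A},\mathbf{D})$ such that $\mathbf{A} \in \mathbb{C}^{K\times K}$ is upper unitriangular (so that $\operatorname{rank}(\mathbf{A}) = K$) and $\mathbf{D} \in \mathbb{C}^{K\times K}$ is diagonal with $|\det \mathbf{D}| = 1$. Then: (i) The problem has a solution (a global minimizer) $(\tilde{\mathbf{A}},\tilde{\mathbf{D}})$ given by $$\tilde{\mathbf{D}} = (\det \mathbf{\Lambda})^{\frac{1}{2K}}\,\mathbf{\Lambda}^{-\frac12}, \qquad \tilde{\mathbf{A}} = \tilde{\mathbf{D}}^{-1}\mathbf{U}^{-1}\tilde{\mathbf{D}} = \mathbf{\Lambda}^{\frac12}\mathbf{U}^{-1}\mathbf{\Lambda}^{-\frac12}.$$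 (ii) The solution for $\mathbf{A}$ as a function of $\mathbf{D}$ is unique: for each fixed diagonal $\mathbf{D} \in \mathbb{C}^{K\times K}$ with $|\det \mathbf{D}| = 1$, the matrix $\mathbf{D}^{-1}\mathbf{U}^{-1}\mathbf{D}$ is the unique minimizer of $\mathbf{A} \mapsto f(\mathbf{A},\mathbf{D})$ over upper unitriangular $\mathbf{A} \in \mathbb{C}^{K\times K}$. (iii) The optimal solution for $\mathbf{D}$ (with the corresponding optimal $\mathbf{A}$) is unique up to a phase shift for each of the diagonal entries: if $(\mathbf{A},\mathbf{D})$ is any solution of the problem, then $\mathbf{D} = \mathbf{\Phi}\tilde{\mathbf{D}}$ for some diagonal matrix $\mathbf{\Phi} \in \mathbb{C}^{K\times K}$ all of whose diagonal entries have modulus $1$, and $\mathbf{A} = \mathbf{D}^{-1}\mathbf{U}^{-1}\mathbf{D}$.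
   Context: $(\cdot)^{\mathrm{H}}$ denotes the conjugate transpose, $\mathrm{Tr}$ the trace, and $\mathbf{I}$ the $K\times K$ identity matrix. A matrix is upper unitriangular if it is upper triangular with all diagonal entries equal to $1$. The matrix $\mathbf{M}$ is Hermitian positive definite, so a factorization $\mathbf{M} = \mathbf{U}^{\mathrm{H}}\mathbf{\Lambda}\mathbf{U}$ with $\mathbf{U}$ upper unitriangular and $\mathbf{\Lambda}$ real diagonal (LDL decomposition) exists, and the diagonal entries of $\mathbf{\Lambda}$ are positive; $\mathbf{\Lambda}^{\pm\frac12}$ denotes the diagonal matrix of positive real powers $\pm\frac12$ of the diagonal entries of $\mathbf{\Lambda}$, and $(\det\mathbf{\Lambda})^{\frac{1}{2K}}$ is the positive real root. *)

theory Defs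
  imports
    "Jordan_Normal_Form.Gauss_Jordan_Elimination"
    "Jordan_Normal_Form.Schur_Decomposition"
begin

(* Unspecified on singular matrices. *)
definition inv_mat :: "'a :: field mat \<Rightarrow> 'a mat" where
  "inv_mat A = the (mat_inverse A)"

lemma inv_mat:
  fixes A :: "'a :: field mat"
  assumes A: "A \<in> carrier_mat n n" and inv: "invertible_mat A"
  shows "A * inv_mat A = 1\<^sub>m n" "inv_mat A * A = 1\<^sub>m n" "inv_mat A \<in> carrier_mat n n"
proof -
  from inv obtain B where AB: "A * B = 1\<^sub>m (dim_row A)" and BA: "B * A = 1\<^sub>m (dim_row B)"
    unfolding invertible_mat_def inverts_mat_def by auto
  have "dim_col (A * B) = n" "dim_col (B * A) = dim_row B"
    using AB BA A by auto
  hence B: "B \<in> carrier_mat n n" using A by auto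
  have "A \<in> Units (ring_mat TYPE('a) n ())"
    using A B AB BA unfolding Units_def ring_mat_def by auto
  then obtain C where "mat_inverse A = Some C"
    using mat_inverse(1)[OF A, of "()"] by (cases "mat_inverse A") auto
  with mat_inverse(2)[OF A this]
  show "A * inv_mat A = 1\<^sub>m n" "inv_mat A * A = 1\<^sub>m n" "inv_mat A \<in> carrier_mat n n"
    unfolding inv_mat_def by auto
qed

definition mat_trace :: "'a :: comm_monoid_add mat \<Rightarrow> 'a" where
  "mat_trace A = (\<Sum>i<dim_row A. A $$ (i, i))"

definition upper_unitriangular :: "nat \<Rightarrow> 'a :: {zero, one} mat \<Rightarrow> bool" where
  "upper_unitriangular n A \<longleftrightarrow>
     A \<in> carrier_mat n n \<and> upper_triangular A \<and> (\<forall>i<n. A $$ (i, i) = 1)"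

definition unimodular_diagonal :: "nat \<Rightarrow> complex mat \<Rightarrow> bool" where
  "unimodular_diagonal n D \<longleftrightarrow>
     D \<in> carrier_mat n n \<and> diagonal_mat D \<and> cmod (det D) = 1"

definition diag_powr :: "real mat \<Rightarrow> real \<Rightarrow> real mat" where
  "diag_powr L a = mat_diag (dim_row L) (\<lambda>i. L $$ (i, i) powr a)"

abbreviation of_real_mat :: "real mat \<Rightarrow> complex mat" where
  "of_real_mat \<equiv> map_mat complex_of_real"

(* The trace is a real number when M is Hermitian, so that taking the real part only
   changes the type; see objective_eq_trace. *)
definition objective :: "complex mat \<Rightarrow> complex mat \<Rightarrow> complex mat \<Rightarrow> real" where
  "objective M A D = Re (mat_trace (mat_adjoint A * mat_adjoint D * M * D * A))"

lemma mat_adjoint_index: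
  "i < dim_col A \<Longrightarrow> j < dim_row A \<Longrightarrow> mat_adjoint A $$ (i, j) = conjugate (A $$ (j, i))"
  unfolding mat_adjoint_def by (simp add: mat_of_rows_index)

lemma mat_adjoint_dims [simp]:
  "dim_row (mat_adjoint A) = dim_col A" "dim_col (mat_adjoint A) = dim_row A"
  unfolding mat_adjoint_def by auto

lemma mat_adjoint_mult_complex:
  fixes A B :: "complex mat"
  assumes "dim_col A = dim_row B"
  shows "mat_adjoint (A * B) = mat_adjoint B * mat_adjoint A"
  using assms
  by (intro eq_matI)
     (auto simp: mat_adjoint_index scalar_prod_def mult.commute intro!: sum.cong)

lemma mat_adjoint_twice:
  fixes A :: "complex mat"
  shows "mat_adjoint (mat_adjoint A) = A"
  by (intro eq_matI) (auto simp: mat_adjoint_index)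

lemma objective_eq_trace:
  assumes "M \<in> carrier_mat n n" "A \<in> carrier_mat n n" "D \<in> carrier_mat n n"
    and M: "mat_adjoint M = M"
  shows "complex_of_real (objective M A D)
           = mat_trace (mat_adjoint A * mat_adjoint D * M * D * A)"
proof -
  let ?X = "mat_adjoint A * mat_adjoint D * M * D * A"
  note [simp] = assms(1-3)[THEN carrier_matD(1)] assms(1-3)[THEN carrier_matD(2)]
  have c: "mat_adjoint A \<in> carrier_mat n n" "mat_adjoint D \<in> carrier_mat n n"
    by (auto intro!: carrier_matI)
  have "mat_adjoint ?X = mat_adjoint A * (mat_adjoint D * (M * (D * A)))"
    by (simp add: mat_adjoint_mult_complex mat_adjoint_twice M)
  also have "\<dots> = ?X"
    using c assms(1-3) by (simp add: assoc_mult_mat[of _ n n _ n _ n])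
  finally have herm: "mat_adjoint ?X = ?X" .
  have "?X $$ (i, i) = cnj (?X $$ (i, i))" if "i < n" for i
    using mat_adjoint_index[of i ?X i] herm that by simp
  hence "Im (?X $$ (i, i)) = 0" if "i < n" for i
    using that by (metis Reals_cnj_iff complex_is_Real_iff)
  hence "Im (mat_trace ?X) = 0"
    unfolding mat_trace_def by simp
  thus ?thesis
    unfolding objective_def by (simp add: complex_eq_iff)
qed

end

theory Submission
  imports Defs
begin

text \<open>Put \<open>W = U D A\<close>. Then the objective equals \<open>\<Sum>i j. \<lambda>\<^sub>i \<bar>W\<^sub>i\<^sub>j\<bar>\<^sup>2\<close>, and \<open>W\<close> is upper triangular with the
  diagonal of \<open>D\<close>, whatever \<open>A\<close> is. For fixed \<open>D\<close> the objective is therefore minimal exactly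
  when \<open>W = D\<close>, that is \<open>A = D\<^sup>-\<^sup>1 U\<^sup>-\<^sup>1 D\<close>, and the minimum is \<open>\<Sum>i. \<lambda>\<^sub>i \<bar>d\<^sub>i\<bar>\<^sup>2\<close>. As \<open>\<Prod>i. \<bar>d\<^sub>i\<bar> = 1\<close>,
  AM-GM bounds this below by \<open>K (det \<Lambda>)\<^sup>1\<^sup>/\<^sup>K\<close>, with equality iff all \<open>\<lambda>\<^sub>i \<bar>d\<^sub>i\<bar>\<^sup>2\<close> coincide, which
  fixes every \<open>\<bar>d\<^sub>i\<bar>\<close>.\<close>

section \<open>Inverses and determinants of diagonal matrices\<close>

text \<open>For square matrices over a field a right inverse is also a left inverse, which gives
  invertibility; associativity then forces it to be the matrix chosen by \<open>inv_mat\<close>.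
  Invertibility is obtained from an explicit right inverse in this way throughout.\<close>

lemma inv_mat_eqI:
  fixes A B :: "'a :: field mat"
  assumes A: "A \<in> carrier_mat n n" and B: "B \<in> carrier_mat n n" and AB: "A * B = 1\<^sub>m n"
  shows "invertible_mat A" and "inv_mat A = B"
proof -
  have BA: "B * A = 1\<^sub>m n" by (rule mat_mult_left_right_inverse[OF A B AB])
  show inv: "invertible_mat A"
    using A B AB BA unfolding invertible_mat_def inverts_mat_def by auto
  note i = inv_mat[OF A inv]
  have "inv_mat A = inv_mat A * (A * B)" using i by (simp add: AB)
  also have "\<dots> = (inv_mat A * A) * B" using assoc_mult_mat[OF i(3) A B] by simp
  also have "\<dots> = B" using i B by simp
  finally show "inv_mat A = B" .
qed

lemma inv_mat_mat_diag:
  fixes d :: "nat \<Rightarrow> 'a :: field"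
  assumes "\<And>i. i < n \<Longrightarrow> d i \<noteq> 0"
  shows "inv_mat (mat_diag n d) = mat_diag n (\<lambda>i. 1 / d i)"
proof (rule inv_mat_eqI(2)[of _ n])
  show "mat_diag n d * mat_diag n (\<lambda>i. 1 / d i) = 1\<^sub>m n"
    unfolding mat_diag_diag using assms by (intro eq_matI) (auto simp: mat_diag_def)
qed auto

lemma diagonal_mat_eq_mat_diag:
  assumes "D \<in> carrier_mat n n" "diagonal_mat D"
  shows "D = mat_diag n (\<lambda>i. D $$ (i, i))"
  using assms by (intro eq_matI) (auto simp: mat_diag_def diagonal_mat_def)

lemma det_mat_diag: "det (mat_diag n d :: 'a :: comm_ring_1 mat) = (\<Prod>i<n. d i)"
proof -
  have "det (mat_diag n d) = prod_list (diag_mat (mat_diag n d))"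
    by (rule det_upper_triangular[of _ n]) (auto simp: mat_diag_def)
  also have "\<dots> = (\<Prod>i<n. d i)"
    by (simp add: prod_list_diag_prod mat_diag_def atLeast0LessThan)
  finally show ?thesis .
qed

text \<open>The determinant is the product of the diagonal entries, so the constraint on
  \<open>D\<close> becomes a condition on the product of their moduli, and a zero entry would make
  that product vanish.\<close>

lemma unimodular_diagonalE:
  assumes "unimodular_diagonal n D"
  obtains d where "D = mat_diag n d" "(\<Prod>i<n. cmod (d i)) = 1" "\<And>i. i < n \<Longrightarrow> d i \<noteq> 0"
proof -
  let ?d = "\<lambda>i. D $$ (i, i)"
  have D: "D = mat_diag n ?d" and det: "cmod (det D) = 1"
    using assms diagonal_mat_eq_mat_diag unfolding unimodular_diagonal_def by auto
  have p: "(\<Prod>i<n. cmod (?d i)) = 1"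
    using det unfolding prod_norm by (subst (asm) D) (simp add: det_mat_diag)
  hence "?d i \<noteq> 0" if "i < n" for i
    using that by (metis finite_lessThan lessThan_iff norm_zero prod_zero zero_neq_one)
  thus thesis using D p that by blast
qed

lemma unimodular_diagonal_mat_diag:
  "unimodular_diagonal n (mat_diag n d) \<longleftrightarrow> (\<Prod>i<n. cmod (d i)) = 1"
  unfolding unimodular_diagonal_def det_mat_diag prod_norm
  by (auto simp: mat_diag_def diagonal_mat_def)

section \<open>Products and inverses of triangular matrices\<close>

text \<open>A term \<open>A $$ (i, k) * B $$ (k, j)\<close> can be nonzero only for
  \<open>i \<le> k\<close> and \<open>k \<le> j\<close>. Below the diagonal no such \<open>k\<close>
  exists, and on it only \<open>k = i\<close> survives.\<close>

lemma upper_triangular_mult_diag: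
  fixes A B :: "'a :: semiring_0 mat"
  assumes A: "A \<in> carrier_mat n n" "upper_triangular A"
    and B: "B \<in> carrier_mat n n" "upper_triangular B"
  shows "upper_triangular (A * B)"
    and "i < n \<Longrightarrow> (A * B) $$ (i, i) = A $$ (i, i) * B $$ (i, i)"
proof -
  have e: "(A * B) $$ (i, j) = (\<Sum>k<n. A $$ (i, k) * B $$ (k, j))" if "i < n" "j < n" for i j
    using that A B by (simp add: scalar_prod_def atLeast0LessThan)
  have z: "A $$ (i, k) * B $$ (k, j) = 0" if "i < n" "j < n" "k < n" "k < i \<or> j < k" for i j k
    using that upper_triangularD[OF A(2), of k i] upper_triangularD[OF B(2), of j k] A(1) B(1)
    by auto
  show "upper_triangular (A * B)"
  proof (rule upper_triangularI)
    fix i j assume "j < i" "i < dim_row (A * B)"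
    thus "(A * B) $$ (i, j) = 0" using A B
      by (subst e) (auto intro!: sum.neutral z)
  qed
  show "(A * B) $$ (i, i) = A $$ (i, i) * B $$ (i, i)" if "i < n"
  proof -
    have "(\<Sum>k\<in>{..<n} - {i}. A $$ (i, k) * B $$ (k, i)) = 0"
      using that by (intro sum.neutral ballI z) auto
    thus ?thesis
      unfolding e[OF that that] using that by (subst sum.remove[of _ i]) auto
  qed
qed

lemma upper_unitriangular_invertible:
  fixes U :: "'a :: field mat"
  assumes "upper_unitriangular n U"
  shows "invertible_mat U"
proof -
  have U: "U \<in> carrier_mat n n" "upper_triangular U" and d: "\<And>i. i < n \<Longrightarrow> U $$ (i, i) = 1"
    using assms unfolding upper_unitriangular_def by auto
  have "det U = 1"
    using det_upper_triangular[OF U(2,1)] U(1) d by (simp add: prod_list_diag_prod)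
  then obtain B where "B \<in> carrier_mat n n" "U * B = 1\<^sub>m n"
    using det_non_zero_imp_unit[OF U(1), of "()"] by (auto simp: Units_def ring_mat_def)
  thus ?thesis using inv_mat_eqI(1)[OF U(1)] by blast
qed

lemma upper_unitriangular_inv_mat:
  fixes U :: "'a :: field mat"
  assumes "upper_unitriangular n U"
  shows "upper_unitriangular n (inv_mat U)"
proof -
  have U: "U \<in> carrier_mat n n" "upper_triangular U" and d: "\<And>i. i < n \<Longrightarrow> U $$ (i, i) = 1"
    using assms unfolding upper_unitriangular_def by auto
  define V where "V = inv_mat U"
  have V: "V \<in> carrier_mat n n" and UV: "U * V = 1\<^sub>m n"
    using inv_mat[OF U(1) upper_unitriangular_invertible[OF assms]] unfolding V_def by auto
  \<comment> \<open>Back substitution from the last row upwards: in row \<open>i\<close> of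
    \<open>U * V = 1\<^sub>m n\<close> the terms with \<open>k < i\<close> vanish because
    \<open>U\<close> is triangular, those with \<open>i < k\<close> by induction.\<close>
  have low: "V $$ (i, j) = 0" if "j < i" "i < n" for i j
    using that
  proof (induction "n - i" arbitrary: i rule: less_induct)
    case less
    have "0 = (U * V) $$ (i, j)" using less.prems by (simp add: UV)
    also have "\<dots> = (\<Sum>k<n. U $$ (i, k) * V $$ (k, j))"
      using less.prems U V by (simp add: scalar_prod_def atLeast0LessThan)
    also have "\<dots> = U $$ (i, i) * V $$ (i, j) + (\<Sum>k\<in>{..<n} - {i}. U $$ (i, k) * V $$ (k, j))"
      using less.prems by (intro sum.remove) auto
    also have "(\<Sum>k\<in>{..<n} - {i}. U $$ (i, k) * V $$ (k, j)) = 0"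
    proof (intro sum.neutral ballI)
      fix k assume k: "k \<in> {..<n} - {i}"
      show "U $$ (i, k) * V $$ (k, j) = 0"
      proof (cases "k < i")
        case True
        thus ?thesis using upper_triangularD[OF U(2), of k i] U(1) less.prems by simp
      next
        case False
        hence "V $$ (k, j) = 0" using k less.prems by (intro less.hyps) auto
        thus ?thesis by simp
      qed
    qed
    finally show ?case using d less.prems by simp
  qed
  hence ut: "upper_triangular V" using V by (intro upper_triangularI) auto
  have "V $$ (i, i) = 1" if "i < n" for i
    using upper_triangular_mult_diag(2)[OF U V ut that] UV d that by simp
  thus ?thesis using V ut unfolding upper_unitriangular_def V_def by auto
qed

section \<open>Regularized Gram matrices and positivity of \<Lambda>\<close>

lemma mat_adjoint_carrier: "X \<in> carrier_mat n m \<Longrightarrow> mat_adjoint X \<in> carrier_mat m n"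
  by (auto intro!: carrier_matI)

text \<open>A diagonal entry of this product is the squared norm of a column of \<open>X\<close>,
  weighted by \<open>l\<close>. It serves both the expansion of the objective and, with unit
  weights, the Gram matrices below.\<close>

lemma adjoint_mat_diag_mult_diag:
  assumes X: "X \<in> carrier_mat n m" and j: "j < m"
  shows "(mat_adjoint X * mat_diag n (\<lambda>i. complex_of_real (l i)) * X) $$ (j, j)
           = complex_of_real (\<Sum>i<n. l i * (cmod (X $$ (i, j)))\<^sup>2)"
proof -
  have "(mat_adjoint X * mat_diag n (\<lambda>i. complex_of_real (l i)) * X) $$ (j, j)
      = (\<Sum>i<n. cnj (X $$ (i, j)) * of_real (l i) * X $$ (i, j))"
    using X j
    by (subst mat_diag_mult_right[of _ m n])
       (auto simp: scalar_prod_def atLeast0LessThan mat_adjoint_index intro!: sum.cong)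
  also have "\<dots> = (\<Sum>i<n. of_real (l i) * (X $$ (i, j) * cnj (X $$ (i, j))))"
    by (intro sum.cong) (auto simp: mult_ac)
  also have "\<dots> = (\<Sum>i<n. complex_of_real (l i * (cmod (X $$ (i, j)))\<^sup>2))"
    unfolding complex_norm_square[symmetric] by simp
  finally show ?thesis by simp
qed

lemma adjoint_mult_self_diag:
  assumes "X \<in> carrier_mat n m" and "j < m"
  shows "(mat_adjoint X * X) $$ (j, j) = complex_of_real (\<Sum>i<n. (cmod (X $$ (i, j)))\<^sup>2)"
proof -
  have "mat_adjoint X * mat_diag n (\<lambda>i. complex_of_real 1) = mat_adjoint X"
    by (simp add: right_mult_one_mat[OF mat_adjoint_carrier[OF assms(1)]])
  with adjoint_mat_diag_mult_diag[OF assms, of "\<lambda>_. 1"] show ?thesis by simp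
qed

lemma mat_adjoint_one: "mat_adjoint (1\<^sub>m n :: complex mat) = 1\<^sub>m n"
  by (intro eq_matI) (auto simp: mat_adjoint_index)

text \<open>The product splits into \<open>c\<close> times the Gram matrix of \<open>X\<close> plus
  the Gram matrix of \<open>mat_adjoint H * X\<close>. Allowing several columns in \<open>X\<close>
  covers a single kernel vector as well as the square \<open>X\<close> used for the positivity of
  \<Lambda>.\<close>

lemma regularized_gram_diag:
  assumes H: "H \<in> carrier_mat n k" and X: "X \<in> carrier_mat n m" and j: "j < m"
  shows "(mat_adjoint X * ((complex_of_real c \<cdot>\<^sub>m 1\<^sub>m n + H * mat_adjoint H) * X)) $$ (j, j)
    = complex_of_real (c * (\<Sum>i<n. (cmod (X $$ (i, j)))\<^sup>2)
        + (\<Sum>i<k. (cmod ((mat_adjoint H * X) $$ (i, j)))\<^sup>2))"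
proof -
  note [simp] = mat_adjoint_carrier[OF H] mat_adjoint_carrier[OF X] H X
  let ?Y = "mat_adjoint H * X"
  have Y: "?Y \<in> carrier_mat k m" by (rule mult_carrier_mat[of _ k n]) auto
  have aY: "mat_adjoint ?Y = mat_adjoint X * H"
    using carrier_matD[OF H] carrier_matD[OF X]
    by (simp add: mat_adjoint_mult_complex mat_adjoint_twice)
  have HH: "H * mat_adjoint H \<in> carrier_mat n n" by (rule mult_carrier_mat[of _ n k]) auto
  have "(complex_of_real c \<cdot>\<^sub>m 1\<^sub>m n + H * mat_adjoint H) * X
      = complex_of_real c \<cdot>\<^sub>m X + H * ?Y"
    using add_mult_distrib_mat[OF _ HH X, of "complex_of_real c \<cdot>\<^sub>m 1\<^sub>m n"]
      mult_smult_assoc_mat[OF one_carrier_mat X, of "complex_of_real c"]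
      assoc_mult_mat[OF H mat_adjoint_carrier[OF H] X] left_mult_one_mat[OF X]
    by simp
  hence "mat_adjoint X * ((complex_of_real c \<cdot>\<^sub>m 1\<^sub>m n + H * mat_adjoint H) * X)
      = complex_of_real c \<cdot>\<^sub>m (mat_adjoint X * X) + mat_adjoint ?Y * ?Y"
    unfolding aY using Y mult_carrier_mat[OF H Y]
    by (simp add: mult_add_distrib_mat[of _ m n _ m] mult_smult_distrib[of _ m n X m]
        assoc_mult_mat[of _ m n H k _ m])
  thus ?thesis
    using adjoint_mult_self_diag[OF X j] adjoint_mult_self_diag[OF Y j] j
      carrier_matD[OF X] carrier_matD[OF Y]
    by simp
qed

text \<open>For a kernel vector \<open>v\<close> the quadratic form gives zero as \<open>c\<close>
  times the squared norm of \<open>v\<close> plus a nonnegative term, so \<open>v = 0\<close>. Since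
  \<open>inv_mat\<close> is unspecified on singular matrices, this is what gives \<open>M\<close>
  its meaning.\<close>

lemma regularized_gram_invertible:
  assumes H: "H \<in> carrier_mat n k" and c: "0 < c"
  shows "invertible_mat (complex_of_real c \<cdot>\<^sub>m 1\<^sub>m n + H * mat_adjoint H)"
proof -
  define G where "G = complex_of_real c \<cdot>\<^sub>m 1\<^sub>m n + H * mat_adjoint H"
  have "H * mat_adjoint H \<in> carrier_mat n n"
    by (rule mult_carrier_mat[OF H mat_adjoint_carrier[OF H]])
  hence G: "G \<in> carrier_mat n n" unfolding G_def by auto
  have "det G \<noteq> 0"
  proof
    assume "det G = 0"
    then obtain v where v: "v \<in> carrier_vec n" "v \<noteq> 0\<^sub>v n" "G *\<^sub>v v = 0\<^sub>v n"
      using det_0_iff_vec_prod_zero[OF G] by auto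
    \<comment> \<open>The kernel vector is turned into a one-column matrix so that
      \<open>regularized_gram_diag\<close> applies.\<close>
    define X where "X = mat_of_cols n [v]"
    have X: "X \<in> carrier_mat n 1" unfolding X_def by auto
    have Xv: "X $$ (i, 0) = v $ i" if "i < n" for i
      using that v unfolding X_def by (simp add: mat_of_cols_index)
    have colX: "col X 0 = v" using v X Xv by (intro eq_vecI) auto
    have "row G i \<bullet> v = 0" if "i < n" for i
      using that G arg_cong[OF v(3), of "\<lambda>w. w $ i"] by simp
    hence "G * X = 0\<^sub>m n 1"
      using G X colX by (intro eq_matI) auto
    hence "complex_of_real (c * (\<Sum>i<n. (cmod (X $$ (i, 0)))\<^sup>2)
        + (\<Sum>i<k. (cmod ((mat_adjoint H * X) $$ (i, 0)))\<^sup>2)) = 0"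
      using regularized_gram_diag[OF H X, of 0 c] unfolding G_def[symmetric]
      by (simp add: right_mult_zero_mat[OF mat_adjoint_carrier[OF X]])
    hence "c * (\<Sum>i<n. (cmod (X $$ (i, 0)))\<^sup>2)
        + (\<Sum>i<k. (cmod ((mat_adjoint H * X) $$ (i, 0)))\<^sup>2) = 0"
      using of_real_eq_0_iff by blast
    moreover have "0 \<le> (\<Sum>i<k. (cmod ((mat_adjoint H * X) $$ (i, 0)))\<^sup>2)"
      "0 \<le> c * (\<Sum>i<n. (cmod (X $$ (i, 0)))\<^sup>2)"
      using c by (auto intro!: sum_nonneg mult_nonneg_nonneg)
    ultimately have "c * (\<Sum>i<n. (cmod (X $$ (i, 0)))\<^sup>2) = 0" by linarith
    hence "(\<Sum>i<n. (cmod (X $$ (i, 0)))\<^sup>2) = 0" using c by simp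
    hence "\<forall>i<n. v $ i = 0" using Xv by (subst (asm) sum_nonneg_eq_0_iff) auto
    thus False using v by auto
  qed
  then obtain B where "B \<in> carrier_mat n n" "G * B = 1\<^sub>m n"
    using det_non_zero_imp_unit[OF G, of "()"] by (auto simp: Units_def ring_mat_def)
  thus ?thesis using inv_mat_eqI(1)[OF G] unfolding G_def by blast
qed

text \<open>Real weights make the diagonal factor its own adjoint, and reversing the product
  restores it. Hence \<open>M\<close> is Hermitian, which gives the adjoint of \<open>M * V\<close>
  in the next lemma.\<close>

lemma LDL_adjoint:
  assumes U: "U \<in> carrier_mat n n"
  shows "mat_adjoint (mat_adjoint U * mat_diag n (\<lambda>i. complex_of_real (l i)) * U)
    = mat_adjoint U * mat_diag n (\<lambda>i. complex_of_real (l i)) * U"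
proof -
  let ?L = "mat_diag n (\<lambda>i. complex_of_real (l i))"
  have L: "?L \<in> carrier_mat n n" by simp
  have "mat_adjoint ?L = ?L"
    by (intro eq_matI) (auto simp: mat_adjoint_index mat_diag_def)
  thus ?thesis
    using U L mat_adjoint_carrier[OF U] carrier_matD[OF L]
    by (simp add: mat_adjoint_mult_complex mat_adjoint_twice assoc_mult_mat[of _ n n _ n _ n])
qed

text \<open>With \<open>G = M\<^sup>-\<^sup>1\<close> and \<open>X = M U\<^sup>-\<^sup>1\<close>, the matrix \<open>\<Lambda> = X\<^sup>H G X\<close> is congruent to \<open>G\<close>.\<close>

lemma LDL_pos:
  assumes H: "H \<in> carrier_mat n k" and c: "0 < c" and U: "upper_unitriangular n U"
    and M: "M = inv_mat (complex_of_real c \<cdot>\<^sub>m 1\<^sub>m n + H * mat_adjoint H)"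
    and LDL: "M = mat_adjoint U * mat_diag n (\<lambda>i. complex_of_real (l i)) * U"
    and i: "i < n"
  shows "0 < l i"
proof -
  define G where "G = complex_of_real c \<cdot>\<^sub>m 1\<^sub>m n + H * mat_adjoint H"
  define L where "L = mat_diag n (\<lambda>i. complex_of_real (l i))"
  define V where "V = inv_mat U"
  define X where "X = M * V"
  have "H * mat_adjoint H \<in> carrier_mat n n"
    by (rule mult_carrier_mat[OF H mat_adjoint_carrier[OF H]])
  hence G: "G \<in> carrier_mat n n" unfolding G_def by auto
  have MG: "M * G = 1\<^sub>m n" "G * M = 1\<^sub>m n" and Mc: "M \<in> carrier_mat n n"
    using inv_mat[OF G] regularized_gram_invertible[OF H c] unfolding M G_def[symmetric] by auto
  have Uc: "U \<in> carrier_mat n n" using U unfolding upper_unitriangular_def by auto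
  have UV: "U * V = 1\<^sub>m n" "V * U = 1\<^sub>m n" and V: "V \<in> carrier_mat n n"
    using inv_mat[OF Uc upper_unitriangular_invertible[OF U]] unfolding V_def by auto
  have L: "L \<in> carrier_mat n n" unfolding L_def by simp
  have X: "X \<in> carrier_mat n n" using Mc V unfolding X_def by auto
  note [simp] = mat_adjoint_carrier[OF V] mat_adjoint_carrier[OF Uc] mat_adjoint_carrier[OF X]
  have GX: "G * X = V"
    using G Mc V by (simp add: X_def MG assoc_mult_mat[symmetric, of G n n])
  have aX: "mat_adjoint X = mat_adjoint V * M"
    unfolding X_def using LDL_adjoint[OF Uc, of l] Mc V
    by (subst mat_adjoint_mult_complex) (auto simp: LDL[symmetric])
  have aVU: "mat_adjoint V * mat_adjoint U = 1\<^sub>m n"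
    using mat_adjoint_mult_complex[of U V] Uc V UV mat_adjoint_one[of n] by simp
  \<comment> \<open>Since \<open>G * X = V\<close>, the left side is the adjoint of \<open>V\<close>
    times \<open>M * V\<close>; inserting the factorization of \<open>M\<close> cancels
    \<open>U\<close> on both sides and leaves \<open>L\<close>.\<close>
  have "mat_adjoint X * (G * X) = mat_adjoint V * (mat_adjoint U * (L * (U * V)))"
    unfolding GX aX LDL L_def[symmetric] using L V Uc
    by (simp add: assoc_mult_mat[of _ n n _ n _ n] mult_carrier_mat[of _ n n _ n])
  also have "\<dots> = (mat_adjoint V * mat_adjoint U) * L"
    using L V Uc by (simp add: UV assoc_mult_mat[of _ n n _ n _ n])
  also have "\<dots> = L" using L by (simp add: aVU)
  finally have "complex_of_real (l i) = complex_of_real (c * (\<Sum>j<n. (cmod (X $$ (j, i)))\<^sup>2)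
      + (\<Sum>j<k. (cmod ((mat_adjoint H * X) $$ (j, i)))\<^sup>2))"
    using regularized_gram_diag[OF H X i, of c] i unfolding G_def[symmetric]
    by (simp add: L_def mat_diag_def)
  hence l: "l i = c * (\<Sum>j<n. (cmod (X $$ (j, i)))\<^sup>2)
      + (\<Sum>j<k. (cmod ((mat_adjoint H * X) $$ (j, i)))\<^sup>2)"
    using of_real_eq_iff by blast
  \<comment> \<open>Strictness: a zero column of \<open>X\<close> would be a zero column of
    \<open>V = G * X\<close>, whose diagonal entries are 1.\<close>
  have "\<exists>j<n. X $$ (j, i) \<noteq> 0"
  proof (rule ccontr)
    assume "\<not> ?thesis"
    hence "V $$ (i, i) = 0"
      unfolding GX[symmetric] using G X i by (auto simp: scalar_prod_def intro!: sum.neutral)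
    thus False
      using upper_unitriangular_inv_mat[OF U] i unfolding V_def upper_unitriangular_def by simp
  qed
  then obtain j where j: "j < n" "X $$ (j, i) \<noteq> 0" by blast
  have "0 < (\<Sum>j<n. (cmod (X $$ (j, i)))\<^sup>2)" using j by (intro sum_pos2[of _ j]) auto
  moreover have "0 \<le> (\<Sum>j<k. (cmod ((mat_adjoint H * X) $$ (j, i)))\<^sup>2)"
    by (auto intro!: sum_nonneg)
  ultimately show ?thesis unfolding l using c by (simp add: add_pos_nonneg)
qed

section \<open>The objective for fixed \<open>D\<close>\<close>

text \<open>Regrouping puts the matrix under the trace in the form adjoint of \<open>W\<close>,
  diagonal factor, \<open>W\<close>, with \<open>W = U * D * A\<close>; the trace then adds up the
  weighted squared norms of the columns of \<open>W\<close>.\<close>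

lemma objective_LDL:
  assumes U: "U \<in> carrier_mat n n" and D: "D \<in> carrier_mat n n" and A: "A \<in> carrier_mat n n"
    and M: "M = mat_adjoint U * mat_diag n (\<lambda>i. complex_of_real (l i)) * U"
  shows "objective M A D = (\<Sum>j<n. \<Sum>i<n. l i * (cmod ((U * D * A) $$ (i, j)))\<^sup>2)"
proof -
  let ?L = "mat_diag n (\<lambda>i. complex_of_real (l i))"
  let ?W = "U * D * A"
  note [simp] = U D A mat_adjoint_carrier[OF U] mat_adjoint_carrier[OF D] mat_adjoint_carrier[OF A]
  have W: "?W \<in> carrier_mat n n" by (intro mult_carrier_mat[of _ n n]) auto
  have aW: "mat_adjoint ?W = mat_adjoint A * (mat_adjoint D * mat_adjoint U)"
    using carrier_matD[OF U] carrier_matD[OF D] carrier_matD[OF A]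
    by (simp add: mat_adjoint_mult_complex)
  have "mat_adjoint A * mat_adjoint D * M * D * A = mat_adjoint ?W * ?L * ?W"
    unfolding aW M by (simp add: assoc_mult_mat[of _ n n _ n _ n] mult_carrier_mat[of _ n n _ n])
  moreover have "dim_row (mat_adjoint ?W * ?L * ?W) = n"
    using carrier_matD[OF A] by simp
  ultimately show ?thesis
    unfolding objective_def mat_trace_def
    by (simp add: adjoint_mat_diag_mult_diag[OF W, of _ l] del: index_mult_mat)
qed

text \<open>Unitriangular factors leave the diagonal of \<open>D\<close> in place, so
  \<open>A\<close> affects only the off-diagonal entries of \<open>U * D * A\<close>. With positive
  weights their contribution is nonnegative and vanishes exactly when all of them do.\<close>

lemma objective_min_A:
  assumes U: "upper_unitriangular n U" and A: "upper_unitriangular n A"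
    and d: "\<And>i. i < n \<Longrightarrow> d i \<noteq> 0" and l: "\<And>i. i < n \<Longrightarrow> 0 < l i"
    and M: "M = mat_adjoint U * mat_diag n (\<lambda>i. complex_of_real (l i)) * U"
  defines "D \<equiv> mat_diag n d"
  shows "(\<Sum>i<n. l i * (cmod (d i))\<^sup>2) \<le> objective M A D"
    and "objective M A D = (\<Sum>i<n. l i * (cmod (d i))\<^sup>2) \<longleftrightarrow> A = inv_mat D * inv_mat U * D"
proof -
  have Uc: "U \<in> carrier_mat n n" "upper_triangular U" "\<And>i. i < n \<Longrightarrow> U $$ (i, i) = 1"
    using U unfolding upper_unitriangular_def by auto
  have Ac: "A \<in> carrier_mat n n" "upper_triangular A" "\<And>i. i < n \<Longrightarrow> A $$ (i, i) = 1"
    using A unfolding upper_unitriangular_def by auto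
  have Dc: "D \<in> carrier_mat n n" "upper_triangular D" "\<And>i. i < n \<Longrightarrow> D $$ (i, i) = d i"
    unfolding D_def mat_diag_def by auto
  define W where "W = U * D * A"
  have UDc: "U * D \<in> carrier_mat n n" using Uc Dc by auto
  note UD = upper_triangular_mult_diag[OF Uc(1,2) Dc(1,2)]
  have W: "W \<in> carrier_mat n n" using UDc Ac unfolding W_def by auto
  have Wut: "upper_triangular W" and Wd: "\<And>i. i < n \<Longrightarrow> W $$ (i, i) = d i"
    using upper_triangular_mult_diag[OF UDc UD(1) Ac(1,2)] UD(2) Uc Dc Ac unfolding W_def by auto
  have V: "inv_mat U \<in> carrier_mat n n" and UV: "U * inv_mat U = 1\<^sub>m n" "inv_mat U * U = 1\<^sub>m n"
    using inv_mat[OF Uc(1) upper_unitriangular_invertible[OF U]] by auto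
  define r where "r = (\<Sum>j<n. \<Sum>i\<in>{..<n} - {j}. l i * (cmod (W $$ (i, j)))\<^sup>2)"
  have "objective M A D = (\<Sum>j<n. \<Sum>i<n. l i * (cmod (W $$ (i, j)))\<^sup>2)"
    unfolding W_def by (rule objective_LDL[OF Uc(1) Dc(1) Ac(1) M])
  also have "\<dots> = (\<Sum>j<n. l j * (cmod (d j))\<^sup>2 + (\<Sum>i\<in>{..<n} - {j}. l i * (cmod (W $$ (i, j)))\<^sup>2))"
    by (intro sum.cong refl, subst sum.remove) (auto simp: Wd)
  finally have obj: "objective M A D = (\<Sum>j<n. l j * (cmod (d j))\<^sup>2) + r"
    unfolding r_def by (simp add: sum.distrib)
  have nn: "0 \<le> l i * (cmod (W $$ (i, j)))\<^sup>2" if "i < n" for i j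
    using l[OF that] by simp
  have "0 \<le> r" unfolding r_def by (intro sum_nonneg nn) auto
  thus "(\<Sum>i<n. l i * (cmod (d i))\<^sup>2) \<le> objective M A D" using obj by simp
  have "r = 0 \<longleftrightarrow> (\<forall>j<n. (\<Sum>i\<in>{..<n} - {j}. l i * (cmod (W $$ (i, j)))\<^sup>2) = 0)"
    unfolding r_def by (subst sum_nonneg_eq_0_iff) (auto intro!: sum_nonneg nn)
  also have "\<dots> \<longleftrightarrow> (\<forall>j<n. \<forall>i\<in>{..<n} - {j}. l i * (cmod (W $$ (i, j)))\<^sup>2 = 0)"
    by (subst sum_nonneg_eq_0_iff) (auto intro!: nn)
  also have "\<dots> \<longleftrightarrow> (\<forall>j<n. \<forall>i<n. i \<noteq> j \<longrightarrow> W $$ (i, j) = 0)"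
  proof -
    have "l i \<noteq> 0" if "i < n" for i using l[OF that] by simp
    thus ?thesis by simp blast
  qed
  \<comment> \<open>The diagonals of \<open>W\<close> and \<open>D\<close> agree already.\<close>
  also have "\<dots> \<longleftrightarrow> W = D"
    using W Wd unfolding D_def mat_diag_def by (auto intro!: eq_matI)
  \<comment> \<open>The equation \<open>U * D * A = D\<close> is solved for \<open>A\<close>, as
    \<open>U\<close> and \<open>D\<close> are invertible.\<close>
  also have "\<dots> \<longleftrightarrow> A = inv_mat D * inv_mat U * D"
  proof -
    have "D * mat_diag n (\<lambda>i. 1 / d i) = 1\<^sub>m n"
      unfolding D_def mat_diag_diag using d by (intro eq_matI) (auto simp: mat_diag_def)
    hence "invertible_mat D" by (rule inv_mat_eqI(1)[OF Dc(1) mat_diag_dim])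
    note Di = inv_mat[OF Dc(1) this]
    show ?thesis
    proof
      assume "W = D"
      hence "inv_mat D * inv_mat U * D = inv_mat D * ((inv_mat U * U) * (D * A))"
        unfolding W_def using Di(3) V Uc(1) Dc(1) Ac(1)
        by (simp add: assoc_mult_mat[of _ n n _ n _ n] mult_carrier_mat[of _ n n _ n])
      also have "\<dots> = (inv_mat D * D) * A"
        using assoc_mult_mat[OF Di(3) Dc(1) Ac(1)] UV(2)
          left_mult_one_mat[OF mult_carrier_mat[OF Dc(1) Ac(1)]] by simp
      also have "\<dots> = A" using Di(2) Ac(1) by simp
      finally show "A = inv_mat D * inv_mat U * D" by simp
    next
      assume A': "A = inv_mat D * inv_mat U * D"
      have "W = U * (D * inv_mat D) * inv_mat U * D"
        unfolding W_def A' using Di(3) V Uc(1) Dc(1) Ac(1)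
        by (simp add: assoc_mult_mat[of _ n n _ n _ n] mult_carrier_mat[of _ n n _ n])
      also have "\<dots> = D" using Di(1) UV(1) right_mult_one_mat[OF Uc(1)] left_mult_one_mat[OF Dc(1)] by simp
      finally show "W = D" .
    qed
  qed
  finally show "objective M A D = (\<Sum>i<n. l i * (cmod (d i))\<^sup>2) \<longleftrightarrow> A = inv_mat D * inv_mat U * D"
    unfolding obj by simp
qed

lemma mat_diag_mult_mult_mat_diag:
  assumes "V \<in> carrier_mat n n"
  shows "mat_diag n a * V * mat_diag n b = mat n n (\<lambda>(i, j). a i * V $$ (i, j) * b j)"
  by (simp add: mat_diag_mult_left[OF assms], subst mat_diag_mult_right[of _ n])
     (auto intro!: eq_matI)

text \<open>Conjugation multiplies entry \<open>(i, j)\<close> by \<open>d j / d i\<close>, which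
  keeps zeros and the unit diagonal. This makes the candidate minimizer feasible.\<close>

lemma upper_unitriangular_diag_conjugate:
  assumes U: "upper_unitriangular n U" and d: "\<And>i. i < n \<Longrightarrow> d i \<noteq> (0 :: 'a :: field)"
  shows "upper_unitriangular n (inv_mat (mat_diag n d) * inv_mat U * mat_diag n d)"
proof -
  have V: "inv_mat U \<in> carrier_mat n n" "upper_triangular (inv_mat U)"
    "\<And>i. i < n \<Longrightarrow> inv_mat U $$ (i, i) = 1"
    using upper_unitriangular_inv_mat[OF U] unfolding upper_unitriangular_def by auto
  have e: "inv_mat (mat_diag n d) * inv_mat U * mat_diag n d
      = mat n n (\<lambda>(i, j). 1 / d i * inv_mat U $$ (i, j) * d j)"
    by (simp add: inv_mat_mat_diag[of n d, OF d] mat_diag_mult_mult_mat_diag[OF V(1)])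
  show ?thesis unfolding e upper_unitriangular_def
    using V d upper_triangularD[OF V(2)] by auto
qed

section \<open>Arithmetic and geometric means, with the equality case\<close>

text \<open>The bound \<open>ln y \<le> y - 1\<close>, with equality only at \<open>y = 1\<close>,
  is summed over \<open>y = x i / g\<close>; the logarithms cancel because these ratios have product
  1. Giving the geometric mean as \<open>g\<close> with \<open>g ^ n\<close> equal to the product
  avoids roots.\<close>

lemma amgm_prod_power:
  fixes x :: "nat \<Rightarrow> real"
  assumes x: "\<And>i. i < n \<Longrightarrow> 0 < x i" and g: "0 < g" and p: "(\<Prod>i<n. x i) = g ^ n"
  shows "real n * g \<le> (\<Sum>i<n. x i)"
    and "(\<Sum>i<n. x i) \<le> real n * g \<Longrightarrow> i < n \<Longrightarrow> x i = g"
proof -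
  \<comment> \<open>The slack in the logarithmic bound; the sum exceeds \<open>real n * g\<close> by
    exactly \<open>g\<close> times the total slack.\<close>
  define t where "t i = x i / g - 1 - ln (x i / g)" for i
  have pos: "0 < x i / g" if "i < n" for i using x[OF that] g by simp
  have t: "0 \<le> t i" if "i < n" for i
    using ln_le_minus_one[OF pos[OF that]] unfolding t_def by simp
  have "(\<Sum>i<n. ln (x i / g)) = ln (\<Prod>i<n. x i / g)"
    using x g by (subst ln_prod) force+
  also have "(\<Prod>i<n. x i / g) = 1" using g by (simp add: prod_dividef p)
  finally have "(\<Sum>i<n. t i) = (\<Sum>i<n. x i) / g - n"
    unfolding t_def by (simp add: sum_subtractf sum_divide_distrib)
  hence s: "(\<Sum>i<n. x i) = real n * g + g * (\<Sum>i<n. t i)"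
    using g by (simp add: field_simps)
  have nn: "0 \<le> (\<Sum>i<n. t i)" by (auto intro!: sum_nonneg t)
  thus "real n * g \<le> (\<Sum>i<n. x i)" unfolding s using g by simp
  assume "(\<Sum>i<n. x i) \<le> real n * g" and i: "i < n"
  hence "g * (\<Sum>i<n. t i) \<le> 0" using s by linarith
  hence "(\<Sum>i<n. t i) = 0" using g nn by (simp add: mult_le_0_iff)
  hence "t i = 0" using i t by (subst (asm) sum_nonneg_eq_0_iff) auto
  hence "x i / g = 1" using ln_eq_minus_one[OF pos[OF i]] unfolding t_def by simp
  thus "x i = g" using g by simp
qed

section \<open>Global optimality, uniqueness in \<open>A\<close>, and uniqueness of \<open>D\<close>
  up to phases\<close>

theorem theorem1:
  fixes K N :: nat and SNR :: real
    and H M U :: "complex mat" and \<Lambda> :: "real mat"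
    and D\<^sub>0 A\<^sub>0 :: "complex mat"
  assumes "1 \<le> K" and "K \<le> N" and "0 < SNR"
    and "H \<in> carrier_mat K N"
    and "M = inv_mat (complex_of_real (real K / SNR) \<cdot>\<^sub>m 1\<^sub>m K + H * mat_adjoint H)"
    and "upper_unitriangular K U"
    and "\<Lambda> \<in> carrier_mat K K" and "diagonal_mat \<Lambda>"
    and "M = mat_adjoint U * of_real_mat \<Lambda> * U"
    and "D\<^sub>0 = complex_of_real (det \<Lambda> powr (1 / (2 * real K)))
                 \<cdot>\<^sub>m of_real_mat (diag_powr \<Lambda> (- 1 / 2))"
    and "A\<^sub>0 = inv_mat D\<^sub>0 * inv_mat U * D\<^sub>0"
  shows
    "is_arg_min (\<lambda>(A, D). objective M A D)
       (\<lambda>(A, D). upper_unitriangular K A \<and> unimodular_diagonal K D) (A\<^sub>0, D\<^sub>0)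
     \<and> A\<^sub>0 = of_real_mat (diag_powr \<Lambda> (1 / 2)) * inv_mat U * of_real_mat (diag_powr \<Lambda> (- 1 / 2))
     \<and> (\<forall>D. unimodular_diagonal K D \<longrightarrow>
          (\<forall>A. is_arg_min (\<lambda>A. objective M A D) (upper_unitriangular K) A
               \<longleftrightarrow> A = inv_mat D * inv_mat U * D))
     \<and> (\<forall>A D. is_arg_min (\<lambda>(A, D). objective M A D)
                (\<lambda>(A, D). upper_unitriangular K A \<and> unimodular_diagonal K D) (A, D) \<longrightarrow>
          (\<exists>\<Phi> \<in> carrier_mat K K. diagonal_mat \<Phi> \<and> (\<forall>i<K. cmod (\<Phi> $$ (i, i)) = 1)
             \<and> D = \<Phi> * D\<^sub>0)
          \<and> A = inv_mat D * inv_mat U * D)"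
proof -
  define l where "l i = \<Lambda> $$ (i, i)" for i
  \<comment> \<open>\<open>c\<^sup>2\<close> is the \<open>K\<close>-th root of
    \<open>det \<Lambda>\<close>, the geometric mean of the \<open>l i\<close>.\<close>
  define c where "c = det \<Lambda> powr (1 / (2 * real K))"
  \<comment> \<open>This scaling makes \<open>l i * (d0 i)\<^sup>2\<close> equal to
    \<open>c\<^sup>2\<close> for every \<open>i\<close>, the equality case of the mean
    inequality.\<close>
  define d0 where "d0 i = c * l i powr (- 1 / 2)" for i
  define V where "V = inv_mat U"
  let ?d0 = "\<lambda>i. complex_of_real (d0 i)"
  let ?ok = "\<lambda>A D. upper_unitriangular K (A :: complex mat) \<and> unimodular_diagonal K D"
  note U = assms(6)
  have L: "\<Lambda> = mat_diag K l"
    unfolding l_def by (rule diagonal_mat_eq_mat_diag[OF assms(7,8)])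
  have "of_real_mat \<Lambda> = mat_diag K (\<lambda>i. complex_of_real (l i))"
    unfolding L by (intro eq_matI) (auto simp: mat_diag_def)
  hence M: "M = mat_adjoint U * mat_diag K (\<lambda>i. complex_of_real (l i)) * U"
    using assms(9) by simp
  \<comment> \<open>The regularization constant \<open>real K / SNR\<close> is positive, so the
    entries of \<Lambda> are positive; the laws for \<open>powr\<close> used below depend on
    this.\<close>
  have l: "0 < l i" if "i < K" for i
    by (rule LDL_pos[OF assms(4) _ U assms(5) M that]) (use assms in auto)
  have det: "det \<Lambda> = (\<Prod>i<K. l i)" unfolding L by (rule det_mat_diag)
  have det_pos: "0 < det \<Lambda>" unfolding det using l by (intro prod_pos) auto
  have c: "0 < c" and c2: "(c\<^sup>2) ^ K = det \<Lambda>"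
  proof -
    show "0 < c" using det_pos unfolding c_def by simp
    have "(c\<^sup>2) ^ K = c powr real (2 * K)"
      by (subst powr_realpow[OF \<open>0 < c\<close>]) (simp add: power_mult)
    also have "\<dots> = det \<Lambda>"
      unfolding c_def using assms(1) det_pos by (simp add: powr_powr)
    finally show "(c\<^sup>2) ^ K = det \<Lambda>" .
  qed
  have sq: "(l i powr (- 1 / 2))\<^sup>2 = 1 / l i" if "i < K" for i
    unfolding power2_eq_square powr_add[symmetric] using l[OF that] by (simp add: powr_minus_divide)
  have d0: "0 < d0 i" and ld0: "l i * (d0 i)\<^sup>2 = c\<^sup>2" if "i < K" for i
    using c l[OF that] sq[OF that] unfolding d0_def by (auto simp: power_mult_distrib)
  have half: "of_real_mat (diag_powr \<Lambda> a) = mat_diag K (\<lambda>i. complex_of_real (l i powr a))" for a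
    unfolding diag_powr_def L by (intro eq_matI) (auto simp: mat_diag_def)
  have D0: "D\<^sub>0 = mat_diag K ?d0"
    unfolding assms(10) half c_def[symmetric] d0_def
    by (intro eq_matI) (auto simp: mat_diag_def)
  \<comment> \<open>Feasibility of \<open>D\<^sub>0\<close>: multiplying the relations
    \<open>ld0\<close> over all \<open>i\<close> shows that the product of the \<open>d0 i\<close>
    has square 1, and it is positive.\<close>
  have "((\<Prod>i<K. d0 i)\<^sup>2) * det \<Lambda> = (\<Prod>i<K. l i * (d0 i)\<^sup>2)"
    unfolding det by (simp add: prod.distrib prod_power_distrib)
  also have "\<dots> = det \<Lambda>" using ld0 by (simp add: c2)
  finally have "(\<Prod>i<K. d0 i)\<^sup>2 = 1" using det_pos by simp
  moreover have "0 < (\<Prod>i<K. d0 i)" using d0 by (intro prod_pos) auto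
  ultimately have "(\<Prod>i<K. d0 i) = 1" by (simp add: power2_eq_1_iff)
  moreover have "(\<Prod>i<K. cmod (?d0 i)) = (\<Prod>i<K. d0 i)"
    using d0 by (intro prod.cong) (auto simp: less_imp_le)
  ultimately have uD0: "unimodular_diagonal K D\<^sub>0"
    unfolding D0 unimodular_diagonal_mat_diag by simp
  have d0_nz: "?d0 i \<noteq> 0" if "i < K" for i using d0[OF that] by simp
  have uA0: "upper_unitriangular K A\<^sub>0"
    unfolding assms(11) D0 by (rule upper_unitriangular_diag_conjugate[OF U d0_nz])
  have f0: "objective M A\<^sub>0 D\<^sub>0 = real K * c\<^sup>2"
  proof -
    have "objective M A\<^sub>0 D\<^sub>0 = (\<Sum>i<K. l i * (cmod (?d0 i))\<^sup>2)"
      unfolding D0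
      by (subst objective_min_A(2)[OF U uA0 d0_nz l M]) (auto simp: assms(11) D0)
    also have "\<dots> = (\<Sum>i<K. c\<^sup>2)" by (intro sum.cong) (auto simp: ld0)
    finally show ?thesis by simp
  qed
  \<comment> \<open>Every feasible \<open>D\<close> leaves the geometric mean of the terms at
    \<open>c\<^sup>2\<close>, so the mean inequality gives one bound for all of them.\<close>
  have prod_eq: "(\<Prod>i<K. l i * (cmod (d i))\<^sup>2) = (c\<^sup>2) ^ K" if "(\<Prod>i<K. cmod (d i)) = 1" for d
    using that by (simp add: c2 det prod.distrib prod_power_distrib[symmetric])
  have c2_pos: "0 < c\<^sup>2" using c by simp
  have lower: "real K * c\<^sup>2 \<le> (\<Sum>i<K. l i * (cmod (d i))\<^sup>2)"
    and lower_eq: "(\<Sum>i<K. l i * (cmod (d i))\<^sup>2) \<le> real K * c\<^sup>2 \<Longrightarrow> i < K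
      \<Longrightarrow> l i * (cmod (d i))\<^sup>2 = c\<^sup>2"
    if "(\<Prod>i<K. cmod (d i)) = 1" and d: "\<And>i. i < K \<Longrightarrow> d i \<noteq> 0" for d i
  proof -
    have pos: "0 < l i * (cmod (d i))\<^sup>2" if "i < K" for i
      using l[OF that] d[OF that] by simp
    note amgm = amgm_prod_power[of K "\<lambda>i. l i * (cmod (d i))\<^sup>2", OF pos c2_pos prod_eq[OF that(1)]]
    show "real K * c\<^sup>2 \<le> (\<Sum>i<K. l i * (cmod (d i))\<^sup>2)" by (rule amgm(1))
    show "l i * (cmod (d i))\<^sup>2 = c\<^sup>2"
      if "(\<Sum>i<K. l i * (cmod (d i))\<^sup>2) \<le> real K * c\<^sup>2" "i < K"
      by (rule amgm(2)[OF _ that])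
  qed
  \<comment> \<open>Two successive bounds: first over \<open>A\<close> for fixed \<open>D\<close>,
    then over the moduli of the diagonal of \<open>D\<close>. The pair
    \<open>(A\<^sub>0, D\<^sub>0)\<close> attains both.\<close>
  have opt: "is_arg_min (\<lambda>(A, D). objective M A D) (\<lambda>(A, D). ?ok A D) (A\<^sub>0, D\<^sub>0)"
    unfolding is_arg_min_linorder
  proof (clarsimp simp: uA0 uD0)
    fix A D :: "complex mat" assume A: "upper_unitriangular K A" and D: "unimodular_diagonal K D"
    obtain d where d: "D = mat_diag K d" "(\<Prod>i<K. cmod (d i)) = 1" "\<And>i. i < K \<Longrightarrow> d i \<noteq> 0"
      using unimodular_diagonalE[OF D] by blast
    have "real K * c\<^sup>2 \<le> (\<Sum>i<K. l i * (cmod (d i))\<^sup>2)" using lower d by blast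
    also have "\<dots> \<le> objective M A D"
      unfolding d(1) by (rule objective_min_A(1)[OF U A d(3) l M])
    finally show "objective M A\<^sub>0 D\<^sub>0 \<le> objective M A D" unfolding f0 .
  qed
  have A0: "A\<^sub>0 = of_real_mat (diag_powr \<Lambda> (1 / 2)) * inv_mat U * of_real_mat (diag_powr \<Lambda> (- 1 / 2))"
  proof -
    have V: "V \<in> carrier_mat K K"
      using upper_unitriangular_inv_mat[OF U] unfolding V_def upper_unitriangular_def by auto
    have q: "complex_of_real (l i powr (1 / 2)) * complex_of_real (l i powr (- 1 / 2)) = 1"
      if "i < K" for i
      unfolding of_real_mult[symmetric] powr_add[symmetric] using l[OF that] by simp
    \<comment> \<open>The scalar \<open>c\<close> cancels in the conjugation, leaving only the
      powers of \<open>l\<close>.\<close>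
    have "1 / ?d0 i * v * ?d0 j
        = complex_of_real (l i powr (1 / 2)) * v * complex_of_real (l j powr (- 1 / 2))"
      if "i < K" for i j v
      using q[OF that] c l[OF that] d0_nz[OF that] unfolding d0_def by (auto simp: field_simps)
    moreover have "inv_mat (mat_diag K ?d0) = mat_diag K (\<lambda>i. 1 / ?d0 i)"
      using d0_nz by (rule inv_mat_mat_diag)
    ultimately show ?thesis
      unfolding assms(11) D0 half V_def[symmetric]
      by (simp only: mat_diag_mult_mult_mat_diag[OF V]) (intro cong_mat; simp)
  qed
  have uniq: "is_arg_min (\<lambda>A. objective M A D) (upper_unitriangular K) A
      \<longleftrightarrow> A = inv_mat D * inv_mat U * D" if D: "unimodular_diagonal K D" for A D
  proof -
    obtain d where d: "D = mat_diag K d" "(\<Prod>i<K. cmod (d i)) = 1" "\<And>i. i < K \<Longrightarrow> d i \<noteq> 0"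
      using unimodular_diagonalE[OF D] by blast
    define B where "B = inv_mat D * inv_mat U * D"
    define s where "s = (\<Sum>i<K. l i * (cmod (d i))\<^sup>2)"
    have B: "upper_unitriangular K B"
      unfolding B_def d(1) by (rule upper_unitriangular_diag_conjugate[OF U d(3)])
    have ge: "s \<le> objective M A D" and eq: "objective M A D = s \<longleftrightarrow> A = B"
      if "upper_unitriangular K A" for A
      using objective_min_A[of K U A d l M, OF U that d(3) l M] unfolding s_def B_def d(1) by auto
    show ?thesis unfolding is_arg_min_linorder B_def[symmetric] using ge eq B
      by (metis order_antisym)
  qed
  have phase: "(\<exists>\<Phi> \<in> carrier_mat K K. diagonal_mat \<Phi> \<and> (\<forall>i<K. cmod (\<Phi> $$ (i, i)) = 1)
        \<and> D = \<Phi> * D\<^sub>0) \<and> A = inv_mat D * inv_mat U * D"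
    if min: "is_arg_min (\<lambda>(A, D). objective M A D) (\<lambda>(A, D). ?ok A D) (A, D)" for A D
  proof -
    have A: "upper_unitriangular K A" and D: "unimodular_diagonal K D"
      using min unfolding is_arg_min_linorder by auto
    \<comment> \<open>Comparison with the feasible pair \<open>(A\<^sub>0, D\<^sub>0)\<close>, whose
      value is \<open>real K * c\<^sup>2\<close>. The variable \<open>D'\<close> admits any
      expression equal to \<open>D\<close>.\<close>
    have le: "objective M A D' \<le> real K * c\<^sup>2" if "D' = D" for D'
      using min uA0 uD0 that unfolding is_arg_min_linorder f0[symmetric] by auto
    obtain d where d: "D = mat_diag K d" "(\<Prod>i<K. cmod (d i)) = 1" "\<And>i. i < K \<Longrightarrow> d i \<noteq> 0"
      using unimodular_diagonalE[OF D] by blast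
    note mA = objective_min_A[of K U A d l M, OF U A d(3) l M, folded d(1)]
    \<comment> \<open>The weighted sum lies between \<open>real K * c\<^sup>2\<close> and the
      objective, which is at most \<open>real K * c\<^sup>2\<close>. Equality in the bound over
      \<open>A\<close> determines \<open>A\<close>; equality in the mean inequality determines the
      moduli \<open>cmod (d i)\<close>.\<close>
    have s: "(\<Sum>i<K. l i * (cmod (d i))\<^sup>2) \<le> real K * c\<^sup>2" using mA(1) le by force
    have "real K * c\<^sup>2 \<le> (\<Sum>i<K. l i * (cmod (d i))\<^sup>2)" using lower d by blast
    hence "objective M A D = (\<Sum>i<K. l i * (cmod (d i))\<^sup>2)" using mA(1) le by force
    hence "A = inv_mat D * inv_mat U * D" using mA(2) by simp
    moreover have dd: "cmod (d i) = d0 i" if "i < K" for i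
    proof -
      have "l i * (cmod (d i))\<^sup>2 = l i * (d0 i)\<^sup>2"
        using lower_eq[OF d(2,3) s that] ld0[OF that] by simp
      thus ?thesis using l[OF that] d0[OF that] by (simp add: power2_eq_iff_nonneg)
    qed
    \<comment> \<open>The phases are the quotients of the two diagonals, of modulus 1 by
      \<open>dd\<close>.\<close>
    let ?P = "mat_diag K (\<lambda>i. d i / ?d0 i)"
    have "D = ?P * D\<^sub>0"
      unfolding d(1) D0 mat_diag_diag using d0_nz by (intro eq_matI) (auto simp: mat_diag_def)
    moreover have "\<forall>i<K. cmod (?P $$ (i, i)) = 1"
      using d0 dd by (auto simp: mat_diag_def norm_divide less_imp_le less_imp_neq[symmetric])
    moreover have "diagonal_mat ?P" by (auto simp: diagonal_mat_def mat_diag_def)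
    ultimately show ?thesis by (intro conjI bexI[of _ ?P]) auto
  qed
  show ?thesis using opt A0 uniq phase by blast
qed

end
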